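(* Let $m>2$ be an integer, and let $C(t)=\sum_{n\ge0}\frac{1}{n+1}\binom{2n}{n}t^n$. For a pattern $\gamma$ put $$F_\gamma(t)=\sum_{n\ge0}\Big(\sum_{\sigma\in\mathcal{S}_n(132)}\mathrm{occr}_\gamma(\sigma)\Big)t^n,\qquad G_\gamma(t)=\sum_{n\ge0}\Big(\sum_{\sigma\in\mathcal{S}_n(123)}\mathrm{occr}_\gamma(\sigma)\Big)t^n.$$ Then $$F_{12\cdots m}(t)=\frac{t\,C(t)\,F_{12\cdots(m-1)}(t)}{1-2t\,C(t)}\qquad\text{and}\qquad G_{1m(m-1)\cdots2}(t)=\frac{t\,C(t)\,G_{1(m-1)(m-2)\cdots2}(t)}{1-2t\,C(t)}.$$
   Context: $\mathcal{S}_n$ is the set of permutations of $\{1,\ldots,n\}$ in one-line notation ($\mathcal{S}_0$ consists of the empty permutation). For a sequence $w$ of distinct integers, $\mathrm{red}(w)$ is the permutation obtained by replacing the $i$-th smallest entry of $w$ by $i$. For $\tau\in\mathcal{S}_j$ and $\sigma=\sigma_1\cdots\sigma_n\in\mathcal{S}_n$, $\mathrm{occr}_\tau(\sigma)$ is the number of index sets $1\le i_1<\cdots<i_j\le n$ with $\mathrm{red}(\sigma_{i_1}\cdots\sigma_{i_j})=\tau$. $\mathcal{S}_n(\tau)$ is the set of $\sigma\in\mathcal{S}_n$ with $\mathrm{occr}_\tau(\sigma)=0$. For $j\ge2$, $12\cdots j$ is the increasing pattern of length $j$, and $1j(j-1)\cdots2$ is the pattern of length $j$ with first entry $1$ followed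 by $j,j-1,\ldots,2$ (so $12$ for $j=2$, $132$ for $j=3$). All identities are between formal power series in $t$. *)

theory Defs
  imports
    "HOL-Combinatorics.Multiset_Permutations"
    "HOL-Computational_Algebra.Formal_Power_Series"
begin

text \<open>Permutations of \<open>{1, \<dots>, n}\<close> are represented in one-line notation, as lists.\<close>

definition Sn :: "nat \<Rightarrow> nat list set" where
  "Sn n = permutations_of_set {1..n}"

text \<open>The \<open>i\<close>-th smallest of distinct entries is the one with exactly \<open>i\<close> entries \<open>\<le>\<close> it.\<close>

definition red :: "'a::linorder list \<Rightarrow> nat list" where
  "red w = map (\<lambda>x. card {y \<in> set w. y \<le> x}) w"

text \<open>Positions are counted from \<open>0\<close>; \<open>nths \<sigma> I\<close> lists the entries of \<open>\<sigma>\<close> at the positions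
  in \<open>I\<close>, in increasing order of position.\<close>

definition occr :: "nat list \<Rightarrow> nat list \<Rightarrow> nat" where
  "occr \<tau> \<sigma> = card {I. I \<subseteq> {..<length \<sigma>} \<and> card I = length \<tau> \<and> red (nths \<sigma> I) = \<tau>}"

definition Av :: "nat \<Rightarrow> nat list \<Rightarrow> nat list set" where
  "Av n \<tau> = {\<sigma> \<in> Sn n. occr \<tau> \<sigma> = 0}"

definition inc_pat :: "nat \<Rightarrow> nat list" where
  "inc_pat j = [1..<Suc j]"

text \<open>The pattern \<open>1 j (j - 1) \<dots> 2\<close>.\<close>

definition one_dec_pat :: "nat \<Rightarrow> nat list" where
  "one_dec_pat j = 1 # rev [2..<Suc j]"

definition catalan_fps :: "rat fps" where
  "catalan_fps = Abs_fps (\<lambda>n. 1 / of_nat (n + 1) * of_nat ((2 * n) choose n))"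

definition total_occr_fps :: "nat list \<Rightarrow> nat list \<Rightarrow> rat fps" where
  "total_occr_fps \<tau> \<gamma> = Abs_fps (\<lambda>n. of_nat (\<Sum>\<sigma>\<in>Av n \<tau>. occr \<gamma> \<sigma>))"

abbreviation F_fps :: "nat list \<Rightarrow> rat fps" where
  "F_fps \<gamma> \<equiv> total_occr_fps [1, 3, 2] \<gamma>"

abbreviation G_fps :: "nat list \<Rightarrow> rat fps" where
  "G_fps \<gamma> \<equiv> total_occr_fps [1, 2, 3] \<gamma>"

end

theory Submission
  imports Defs "HOL-Library.Sublist"
begin

text \<open>In a \<open>132\<close>-avoiding (\<open>123\<close>-avoiding) permutation, the larger entries to the right of an entry
  \<open>x\<close> automatically increase (decrease). So an occurrence of \<open>12\<cdots>m\<close> (of \<open>1m(m-1)\<cdots>2\<close>) is a choice of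
  \<open>x\<close> and of \<open>m - 1\<close> of these entries, and both sides count \<open>\<Sum>\<^sub>x (r(x) choose (m - 1))\<close> where \<open>r(x)\<close>
  is the number of larger entries to the right of \<open>x\<close>.

  Place the entries from left to right, remembering the current minimum \<open>v\<close>: the next entry is
  either any of the remaining entries below \<open>v\<close>, or the one remaining entry above \<open>v\<close> that the
  avoidance condition forces. If \<open>a\<close> entries below and \<open>b\<close> entries above \<open>v\<close> remain, the
  number of completions is the coefficient of \<open>t\<^sup>a\<close> in \<open>C(t)\<^sup>b\<^sup>+\<^sup>1\<close>, because \<open>C = 1 + tC\<^sup>2\<close>. The
  generating functions \<open>H\<^sub>b\<close> of the total counts satisfy
  \<open>H\<^sub>b = t H\<^sub>b\<^sub>+\<^sub>1 + H\<^sub>b\<^sub>-\<^sub>1 + (known terms)\<close>, which the substitution \<open>D\<^sub>b = H\<^sub>b - C H\<^sub>b\<^sub>-\<^sub>1\<close> turns into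
  \<open>D\<^sub>b = t C D\<^sub>b\<^sub>+\<^sub>1 + c (b choose k) C\<^sup>b\<close>, up to a shift of \<open>b\<close> in the \<open>132\<close> case. Pascal's rule then
  relates the solutions for \<open>k\<close> and \<open>k + 1\<close>.\<close>

unbundle fps_syntax

subsection \<open>Powers of the Catalan series\<close>

text \<open>Two absorption identities link the central binomial coefficients at \<open>n + 1\<close>
  and \<open>n\<close>. The recurrence is the coefficient form of the differential equation behind
  \<open>catalan_fps_eq\<close>.\<close>

lemma catalan_Suc:
  "of_nat (n + 2) * (catalan_fps $ Suc n) = of_nat (4 * n + 2) * catalan_fps $ n"
proof -
  have 1: "Suc n * (2 * Suc n choose Suc n) = 2 * Suc n * (Suc (2 * n) choose n)"
    using Suc_times_binomial_eq[of "Suc (2*n)" n] by simp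
  have 2: "Suc n * (Suc (2 * n) choose n) = Suc (2 * n) * (2 * n choose n)"
    using Suc_times_binomial_eq[of "2 * n" n] binomial_symmetric[of n "Suc (2 * n)"]
    by (simp add: mult.commute del: binomial_Suc_Suc)
  have "Suc n * (Suc n * (2 * Suc n choose Suc n)) = 2 * Suc n * (Suc n * (Suc (2 * n) choose n))"
    unfolding 1 by (simp only: mult_ac)
  also have "\<dots> = Suc n * (2 * (Suc (2 * n) * (2 * n choose n)))"
    unfolding 2 by (simp only: mult_ac)
  finally have "Suc n * (2 * Suc n choose Suc n) = 2 * (Suc (2 * n) * (2 * n choose n))"
    by (simp only: mult_cancel1) simp
  then have "of_nat (Suc n * (2 * Suc n choose Suc n)) =
      (of_nat (2 * (Suc (2 * n) * (2 * n choose n))) :: rat)" by presburger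
  then have "of_nat (Suc n) * of_nat (2 * Suc n choose Suc n) =
      (of_nat (4 * n + 2) * of_nat (2 * n choose n) :: rat)" by (simp add: algebra_simps)
  then show ?thesis
    unfolding catalan_fps_def fps_nth_Abs_fps
    by (simp add: field_simps del: binomial_Suc_Suc mult_Suc_right)
qed

text \<open>By \<open>catalan_Suc\<close>, W = 1 - 2tC satisfies (1 - 4t)W' = -2W, the equation of
  the square root of 1 - 4t. Once W^2 = 1 - 4t is known, expanding and cancelling 4t gives the
  claim.\<close>

lemma catalan_fps_eq: "catalan_fps = 1 + fps_X * catalan_fps ^ 2"
proof -
  define W where "W = 1 - 2 * fps_X * catalan_fps"
  have W: "(1 - 4 * fps_X) * fps_deriv W = - 2 * W"
  proof (rule fps_ext)
    fix n
    have Wn: "W $ Suc i = - 2 * catalan_fps $ i" for i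
      by (simp add: W_def mult.assoc fps_numeral_nth numeral_fps_const)
    have W0: "W $ 0 = 1" by (simp add: W_def)
    show "((1 - 4 * fps_X) * fps_deriv W) $ n = (- 2 * W) $ n"
    proof (cases n)
      case 0
      then show ?thesis by (simp add: Wn W0 catalan_fps_def)
    next
      case (Suc i)
      then show ?thesis using catalan_Suc[of i]
        by (simp add: left_diff_distrib mult.assoc numeral_fps_const Wn algebra_simps)
    qed
  qed
  define U where "U = W ^ 2"
  have U: "(1 - 4 * fps_X) * fps_deriv U = - 4 * U"
  proof -
    have "(1 - 4 * fps_X) * fps_deriv U = 2 * W * ((1 - 4 * fps_X) * fps_deriv W)"
      by (simp add: U_def power2_eq_square algebra_simps)
    also have "\<dots> = - 4 * U" unfolding W by (simp add: U_def power2_eq_square algebra_simps)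
    finally show ?thesis .
  qed
  have rec: "of_nat (n + 1) * U $ Suc n = 4 * (of_nat n - 1) * U $ n" for n
  proof -
    have "((1 - 4 * fps_X) * fps_deriv U) $ n = (- 4 * U) $ n" by (simp only: U)
    then show ?thesis
      by (cases n) (simp_all add: left_diff_distrib mult.assoc numeral_fps_const algebra_simps)
  qed
  have U0: "U $ 0 = 1" by (simp add: U_def W_def fps_power_zeroth)
  have U1: "U $ Suc 0 = -4" using rec[of 0] U0 by simp
  \<comment> \<open>The factor n - 1 in \<open>rec\<close> vanishes at n = 1, which kills this
    coefficient and all later ones.\<close>
  have U2: "U $ Suc (Suc n) = 0" for n
  proof (induction n)
    case 0
    then show ?case using rec[of 1] by simp
  next
    case (Suc n)
    then show ?case using rec[of "Suc (Suc n)"]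
      by (metis mult_eq_0_iff of_nat_eq_0_iff add_is_0 one_neq_zero)
  qed
  have "U = 1 - 4 * fps_X"
  proof (rule fps_ext)
    fix n
    consider "n = 0" | "n = 1" | i where "n = Suc (Suc i)" by (metis One_nat_def not0_implies_Suc)
    then show "U $ n = (1 - 4 * fps_X) $ n"
      by cases (simp_all add: U0 U1 U2 numeral_fps_const)
  qed
  moreover have "U = 1 - 4 * fps_X * catalan_fps + 4 * fps_X * (fps_X * catalan_fps ^ 2)"
    unfolding U_def W_def by (simp add: power2_eq_square algebra_simps)
  ultimately have "(4 * fps_X) * catalan_fps = (4 * fps_X) * (1 + fps_X * catalan_fps ^ 2)"
    by (simp add: algebra_simps)
  moreover have "(4 * fps_X :: rat fps) \<noteq> 0" by simp
  ultimately show ?thesis by (rule mult_left_cancel[THEN iffD1, rotated])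
qed

lemma catalan_power_Suc:
  "catalan_fps ^ Suc b = fps_X * catalan_fps ^ Suc (Suc b) + catalan_fps ^ b"
proof -
  have "catalan_fps ^ Suc b = catalan_fps ^ b * (1 + fps_X * catalan_fps ^ 2)"
    unfolding power_Suc2 by (subst (2) catalan_fps_eq) (rule refl)
  also have "\<dots> = fps_X * catalan_fps ^ Suc (Suc b) + catalan_fps ^ b"
    by (simp add: algebra_simps power2_eq_square)
  finally show ?thesis .
qed

text \<open>This is the recursion over the next entry: the first term is the forced larger entry,
  the j-th summand a new minimum with j smaller entries left. It results from unrolling
  \<open>catalan_power_Suc\<close> in its shifted term.\<close>

lemma catalan_power_nth:
  "catalan_fps ^ Suc b $ a = catalan_fps ^ b $ a + (\<Sum>j<a. catalan_fps ^ (b + a - j) $ j)"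
proof (induction a arbitrary: b)
  case 0
  show ?case unfolding catalan_power_Suc[of b] by (simp del: power_Suc)
next
  case (Suc a)
  have "catalan_fps ^ Suc b $ Suc a = catalan_fps ^ b $ Suc a + catalan_fps ^ Suc (Suc b) $ a"
    using arg_cong[OF catalan_power_Suc[of b], of "\<lambda>f. f $ Suc a"] by (simp del: power_Suc)
  also have "catalan_fps ^ Suc (Suc b) $ a = (\<Sum>j<Suc a. catalan_fps ^ (b + Suc a - j) $ j)"
    unfolding Suc[of "Suc b"] sum.lessThan_Suc by (simp del: power_Suc)
  finally show ?case .
qed

text \<open>Weighted analogue of \<open>catalan_power_nth\<close>: \<open>e\<close> weights the
  forced larger entry, \<open>h\<close> a new minimum. Unrolling \<open>H (Suc b)\<close> produces a
  term with \<open>e (Suc b)\<close> where \<open>h b\<close> is wanted; the last term of the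
  assumption corrects this.\<close>

lemma first_letter_recurrence:
  fixes H :: "nat \<Rightarrow> rat fps" and e h :: "nat \<Rightarrow> rat"
  assumes H: "\<And>b. H b = fps_X * H (Suc b)
      + (if b = 0 then 0 else H (b - 1) + fps_const (e b) * catalan_fps ^ b)
      + fps_X * fps_const (h b - e (Suc b)) * catalan_fps ^ Suc b"
  shows "H b $ a = (if b = 0 then 0 else H (b - 1) $ a + e b * catalan_fps ^ b $ a)
      + (\<Sum>j<a. H (b + a - Suc j) $ j + h (b + a - Suc j) * catalan_fps ^ (b + a - j) $ j)"
proof (induction a arbitrary: b)
  case 0
  show ?case by (subst H) (simp add: mult.assoc)
next
  case (Suc a)
  have "H b $ Suc a = H (Suc b) $ a
      + (if b = 0 then 0 else H (b - 1) $ Suc a + e b * catalan_fps ^ b $ Suc a)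
      + (h b - e (Suc b)) * catalan_fps ^ Suc b $ a"
    by (subst H) (simp add: mult.assoc del: power_Suc)
  also have "H (Suc b) $ a = H b $ a + e (Suc b) * catalan_fps ^ Suc b $ a
      + (\<Sum>j<a. H (b + Suc a - Suc j) $ j + h (b + Suc a - Suc j) * catalan_fps ^ (b + Suc a - j) $ j)"
    by (subst Suc) (simp del: power_Suc)
  finally show ?case by (simp add: algebra_simps del: power_Suc)
qed

subsection \<open>Solving the recurrences\<close>

text \<open>Iterating the recurrence for D with k = 0 gives C^b times the geometric series in tC^2,
  which is this series.\<close>

definition catalan_ratio :: "rat fps" where
  "catalan_ratio = inverse (1 - fps_X * catalan_fps ^ 2)"

text \<open>The solution of \<open>D\<^sub>b = t C D\<^sub>b\<^sub>+\<^sub>1 + (b choose k) C\<^sup>b\<close>, see \<open>weighted_rec\<close>.\<close>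

fun weighted :: "nat \<Rightarrow> nat \<Rightarrow> rat fps" where
  "weighted 0 b = catalan_fps ^ b * catalan_ratio"
| "weighted (Suc k) 0 = fps_X * catalan_fps ^ 2 * catalan_ratio * weighted k 0"
| "weighted (Suc k) (Suc b) = catalan_fps * (weighted (Suc k) b + weighted k b)"

lemma catalan_ratio: "catalan_ratio = 1 + fps_X * catalan_fps ^ 2 * catalan_ratio"
proof -
  have "(1 - fps_X * catalan_fps ^ 2) * catalan_ratio = 1"
    unfolding catalan_ratio_def by (rule inverse_mult_eq_1') simp
  then show ?thesis by (simp add: algebra_simps)
qed

text \<open>With x = tC^2, raising k multiplies the value at b = 0 by x/(1 - x). This division-free
  form is what \<open>catalan_solve\<close> takes.\<close>

lemma weighted_Suc_0:
  "weighted (Suc k) 0 = fps_X * catalan_fps ^ 2 * (weighted (Suc k) 0 + weighted k 0)"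
proof -
  have "weighted (Suc k) 0 =
      fps_X * catalan_fps ^ 2 * ((1 + fps_X * catalan_fps ^ 2 * catalan_ratio) * weighted k 0)"
    using catalan_ratio by simp
  also have "\<dots> = fps_X * catalan_fps ^ 2 * (weighted (Suc k) 0 + weighted k 0)"
    by (simp add: algebra_simps)
  finally show ?thesis .
qed

text \<open>In the main case the hypotheses for \<open>Suc k\<close> and \<open>k\<close> at
  \<open>b\<close> are added, and Pascal's rule merges their binomial coefficients. At b = 0 with
  \<open>Suc k\<close> the binomial coefficient vanishes.\<close>

lemma weighted_rec:
  "weighted k b = fps_X * catalan_fps * weighted k (Suc b) +
     fps_const (of_nat (b choose k)) * catalan_fps ^ b"
proof (induction k b rule: weighted.induct)
  case (1 b)
  have "weighted 0 b = catalan_fps ^ b * (1 + fps_X * catalan_fps ^ 2 * catalan_ratio)"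
    using catalan_ratio by simp
  also have "\<dots> = fps_X * catalan_fps * weighted 0 (Suc b) + fps_const (of_nat (b choose 0)) * catalan_fps ^ b"
    by (simp add: algebra_simps power2_eq_square)
  finally show ?case .
next
  case (2 k)
  have "weighted (Suc k) 0 = fps_X * catalan_fps ^ 2 * (weighted (Suc k) 0 + weighted k 0)"
    by (rule weighted_Suc_0)
  also have "\<dots> = fps_X * catalan_fps * weighted (Suc k) (Suc 0)"
    by (simp only: weighted.simps(3) power2_eq_square mult.assoc)
  finally show ?case by simp
next
  case (3 k b)
  have "weighted (Suc k) (Suc b) = catalan_fps * (weighted (Suc k) b + weighted k b)" by simp
  also have "\<dots> = fps_X * catalan_fps * (catalan_fps * (weighted (Suc k) (Suc b) + weighted k (Suc b)))
     + (fps_const (of_nat (b choose Suc k)) + fps_const (of_nat (b choose k))) * catalan_fps ^ Suc b"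
    by (subst 3(1), subst 3(2)) (simp only: algebra_simps power_Suc)
  also have "fps_const (of_nat (b choose Suc k)) + fps_const (of_nat (b choose k)) =
      (fps_const (of_nat (Suc b choose Suc k)) :: rat fps)" by (simp add: add.commute)
  also have "catalan_fps * (weighted (Suc k) (Suc b) + weighted k (Suc b)) =
      weighted (Suc k) (Suc (Suc b))" by simp
  finally show ?case .
qed

text \<open>Collecting P gives (1 - tC^2)P = tC^2 Q, and 1 - tC^2 = C(1 - 2tC) by the quadratic
  equation, so a factor C cancels.\<close>

lemma catalan_solve:
  assumes "P = fps_X * catalan_fps ^ 2 * (P + Q)"
  shows "P = fps_X * catalan_fps * Q / (1 - 2 * fps_X * catalan_fps)"
proof -
  let ?C = catalan_fps
  have "?C * (P * (1 - 2 * fps_X * ?C)) = P * ?C - 2 * P * (fps_X * ?C ^ 2)"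
    by (simp add: algebra_simps power2_eq_square)
  also have "fps_X * ?C ^ 2 = ?C - 1" using catalan_fps_eq by (simp add: algebra_simps)
  also have "P * ?C - 2 * P * (?C - 1) = P - P * (?C - 1)" by (simp add: algebra_simps)
  also have "?C - 1 = fps_X * ?C ^ 2" using catalan_fps_eq by (simp add: algebra_simps)
  also have "P - P * (fps_X * ?C ^ 2) = ?C * (fps_X * ?C * Q)"
    using assms by (simp add: algebra_simps power2_eq_square)
  finally have "P * (1 - 2 * fps_X * ?C) = fps_X * ?C * Q"
    using catalan_fps_eq by (metis add_cancel_left_right mult_cancel_left mult_zero_right
        power2_eq_square zero_neq_one)
  moreover have "(1 - 2 * fps_X * ?C) $ 0 \<noteq> 0" by simp
  then have "1 - 2 * fps_X * ?C \<noteq> 0" by (metis fps_zero_nth)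
  ultimately show ?thesis by (metis nonzero_mult_div_cancel_right)
qed

section \<open>Explicit series for the total counts\<close>

text \<open>These are the H of the \<open>123\<close> case: the difference D is tC^2 times
  \<open>weighted k b\<close>, and H at index -1 is read as 0.\<close>

fun total_123 :: "nat \<Rightarrow> nat \<Rightarrow> rat fps" where
  "total_123 k 0 = fps_X * catalan_fps ^ 2 * weighted k 0"
| "total_123 k (Suc b) = fps_X * catalan_fps ^ 2 * weighted k (Suc b) + catalan_fps * total_123 k b"

text \<open>The known term (b - 1 choose k)C^b is present only for b > 0. So D at
  \<open>Suc b\<close> is C^2 times \<open>weighted k b\<close>, and D at 0 is tC times D at
  1.\<close>

fun total_132 :: "nat \<Rightarrow> nat \<Rightarrow> rat fps" where
  "total_132 k 0 = fps_X * catalan_fps ^ 3 * weighted k 0"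
| "total_132 k (Suc b) = catalan_fps ^ 2 * weighted k b + catalan_fps * total_132 k b"

lemma total_123_rec:
  "total_123 k b = fps_X * total_123 k (Suc b) + (if b = 0 then 0 else total_123 k (b - 1))
     + fps_X * fps_const (of_nat (b choose k)) * catalan_fps ^ Suc b"
proof -
  let ?C = catalan_fps
  \<comment> \<open>Reading the predecessor as 0 at b = 0 puts both defining equations into the
    single form \<open>t\<close>.\<close>
  define p where "p = (if b = 0 then 0 else total_123 k (b - 1))"
  have t: "total_123 k b = fps_X * ?C ^ 2 * weighted k b + ?C * p"
    by (cases b) (simp_all add: p_def)
  have w: "fps_X * ?C * weighted k b = fps_X * (fps_X * ?C ^ 2 * weighted k (Suc b))
      + fps_X * fps_const (of_nat (b choose k)) * ?C ^ Suc b"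
    by (subst weighted_rec) (simp add: algebra_simps power2_eq_square)
  have "fps_X * total_123 k (Suc b) + p + fps_X * fps_const (of_nat (b choose k)) * ?C ^ Suc b
    = fps_X * ?C * weighted k b + fps_X * ?C * total_123 k b + p"
    unfolding w by (simp add: algebra_simps)
  also have "\<dots> = fps_X * ?C * weighted k b * (1 + fps_X * ?C ^ 2) + p * (1 + fps_X * ?C ^ 2)"
    unfolding t by (simp add: algebra_simps power2_eq_square)
  also have "\<dots> = total_123 k b"
    unfolding t catalan_fps_eq[symmetric] by (simp add: algebra_simps power2_eq_square)
  finally show ?thesis by (simp add: p_def)
qed

lemma total_132_rec:
  "total_132 k b = fps_X * total_132 k (Suc b) + (if b = 0 then 0 else
       total_132 k (b - 1) + fps_const (of_nat (b - 1 choose k)) * catalan_fps ^ b)"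
proof -
  let ?C = catalan_fps
  \<comment> \<open>Here \<open>p\<close> stands for the whole right-hand side except the shifted
    term; a factor 1 + tC^2 = C splits off.\<close>
  have 1: "fps_X * total_132 k (Suc b) + p = total_132 k b"
    if "total_132 k b = ?C * (fps_X * ?C ^ 2 * weighted k b + p)" for p
  proof -
    have "fps_X * total_132 k (Suc b) + p =
      fps_X * ?C ^ 2 * weighted k b * (1 + fps_X * ?C ^ 2) + p * (1 + fps_X * ?C ^ 2)"
      by (simp add: that algebra_simps power2_eq_square)
    also have "\<dots> = total_132 k b"
      unfolding that catalan_fps_eq[symmetric] by (simp add: algebra_simps power2_eq_square)
    finally show ?thesis .
  qed
  show ?thesis
  proof (cases b)
    case 0
    then show ?thesis using 1[of 0] by (simp add: algebra_simps power2_eq_square power3_eq_cube)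
  next
    case (Suc i)
    have "total_132 k b = ?C * (fps_X * ?C ^ 2 * weighted k b +
        (total_132 k i + fps_const (of_nat (i choose k)) * ?C ^ b))"
      unfolding Suc total_132.simps
      by (subst weighted_rec) (simp add: algebra_simps power2_eq_square)
    then show ?thesis using 1 Suc by simp
  qed
qed

text \<open>At b = 0 the total is \<open>weighted k 0\<close> times a factor free of k, so the
  relation of \<open>weighted_Suc_0\<close> carries over.\<close>

lemma total_123_solve: "total_123 (Suc k) 0 =
    fps_X * catalan_fps * total_123 k 0 / (1 - 2 * fps_X * catalan_fps)"
  by (rule catalan_solve) (subst total_123.simps, subst weighted_Suc_0, simp only: total_123.simps algebra_simps)

lemma total_132_solve: "total_132 (Suc k) 0 =
    fps_X * catalan_fps * total_132 k 0 / (1 - 2 * fps_X * catalan_fps)"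
  by (rule catalan_solve) (subst total_132.simps, subst weighted_Suc_0, simp only: total_132.simps algebra_simps)

subsection \<open>Generating avoiders from left to right\<close>

text \<open>On distinct entries, \<open>R\<close> = \<open>(<)\<close> expresses avoidance of 132
  and \<open>R\<close> = \<open>(>)\<close> avoidance of 123.\<close>

fun fan_sorted :: "('a::linorder \<Rightarrow> 'a \<Rightarrow> bool) \<Rightarrow> 'a list \<Rightarrow> bool" where
  "fan_sorted R [] \<longleftrightarrow> True"
| "fan_sorted R (x # xs) \<longleftrightarrow> sorted_wrt R (filter (\<lambda>y. x < y) xs) \<and> fan_sorted R xs"

fun fan_count :: "nat \<Rightarrow> 'a::linorder list \<Rightarrow> nat" where
  "fan_count k [] = 0"
| "fan_count k (x # xs) = (length (filter (\<lambda>y. x < y) xs) choose k) + fan_count k xs"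

text \<open>\<open>v\<close> is the least entry placed so far and \<open>S\<close> holds the
  remaining ones. Placed entries above \<open>v\<close> add no constraint, since whatever exceeds
  them also exceeds \<open>v\<close>.\<close>

definition fan_perms :: "('a::linorder \<Rightarrow> 'a \<Rightarrow> bool) \<Rightarrow> 'a \<Rightarrow> 'a set \<Rightarrow> 'a list set" where
  "fan_perms R v S = {w \<in> permutations_of_set S. fan_sorted R (v # w)}"

lemma filter_filter_greater:
  "v \<le> x \<Longrightarrow> filter (\<lambda>y. x < y) (filter (\<lambda>y. v < y) xs) = filter (\<lambda>y. x < y) (xs :: 'a::linorder list)"
  unfolding filter_filter by (intro filter_cong) auto

text \<open>A new minimum takes over: the entries above \<open>v\<close> are among those above
  \<open>x\<close>.\<close>

lemma fan_sorted_Cons_less: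
  assumes "x < v"
  shows "fan_sorted R (v # x # w) \<longleftrightarrow> fan_sorted R (x # w)"
  using assms sorted_wrt_filter[of R "filter (\<lambda>y. x < y) w" "\<lambda>y. v < y"]
    filter_filter_greater[of x v w] by auto

text \<open>Entries above \<open>x\<close> are also above \<open>v\<close>, so the condition at
  \<open>x\<close> follows from that at \<open>v\<close>.\<close>

lemma fan_sorted_Cons_greater:
  assumes "v < x"
  shows "fan_sorted R (v # x # w) \<longleftrightarrow>
    (\<forall>y\<in>set w. v < y \<longrightarrow> R x y) \<and> fan_sorted R (v # w)"
  using assms sorted_wrt_filter[of R "filter (\<lambda>y. v < y) w" "\<lambda>y. x < y"]
    filter_filter_greater[of v x w] by auto

lemma sum_permutations_of_set:
  assumes "finite S" "S \<noteq> {}"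
  shows "(\<Sum>w\<in>permutations_of_set S. f w) = (\<Sum>x\<in>S. \<Sum>w\<in>permutations_of_set (S - {x}). f (x # w))"
proof -
  have "(\<Sum>w\<in>permutations_of_set S. f w) =
      (\<Sum>x\<in>S. \<Sum>w\<in>(#) x ` permutations_of_set (S - {x}). f w)"
    unfolding permutations_of_set_nonempty[OF assms(2)]
    using assms by (intro sum.UNION_disjoint) auto
  also have "\<dots> = (\<Sum>x\<in>S. \<Sum>w\<in>permutations_of_set (S - {x}). f (x # w))"
    by (simp add: sum.reindex inj_on_def)
  finally show ?thesis .
qed

text \<open>Split by the first entry: one below \<open>v\<close> replaces \<open>v\<close> as the
  minimum; one above keeps \<open>v\<close> and must be related by \<open>R\<close> to all remaining
  entries above \<open>v\<close>.\<close>

lemma sum_fan_perms: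
  assumes S: "finite S" "S \<noteq> {}" "v \<notin> S"
  shows "(\<Sum>w\<in>fan_perms R v S. f w) =
    (\<Sum>x\<in>{x\<in>S. x < v}. \<Sum>w\<in>fan_perms R x (S - {x}). f (x # w)) +
    (\<Sum>x\<in>{x\<in>S. v < x \<and> (\<forall>y\<in>S - {x}. v < y \<longrightarrow> R x y)}.
      \<Sum>w\<in>fan_perms R v (S - {x}). f (x # w))"
proof -
  let ?g = "\<lambda>x. \<Sum>w | w \<in> permutations_of_set (S - {x}) \<and> fan_sorted R (v # x # w). f (x # w)"
  have fin: "finite (permutations_of_set A)" for A :: "'a set" by simp
  have "(\<Sum>w\<in>fan_perms R v S. f w) =
      (\<Sum>w\<in>permutations_of_set S. if fan_sorted R (v # w) then f w else 0)"
    unfolding fan_perms_def by (rule sum.inter_filter) simp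
  also have "\<dots> = (\<Sum>x\<in>S. ?g x)"
    unfolding sum_permutations_of_set[OF S(1,2)]
    by (intro sum.cong refl sum.inter_filter[symmetric] fin)
  also have "\<dots> = (\<Sum>x\<in>{x\<in>S. x < v}. ?g x) + (\<Sum>x\<in>{x\<in>S. v < x}. ?g x)"
  proof -
    have "S = {x\<in>S. x < v} \<union> {x\<in>S. v < x}" using S(3) linorder_less_linear[of _ v] by blast
    then have "sum ?g S = sum ?g ({x\<in>S. x < v} \<union> {x\<in>S. v < x})" by (rule arg_cong)
    also have "\<dots> = sum ?g {x\<in>S. x < v} + sum ?g {x\<in>S. v < x}"
      by (rule sum.union_disjoint) (use S(1) in auto)
    finally show ?thesis .
  qed
  also have "(\<Sum>x\<in>{x\<in>S. x < v}. ?g x) =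
      (\<Sum>x\<in>{x\<in>S. x < v}. \<Sum>w\<in>fan_perms R x (S - {x}). f (x # w))"
    unfolding fan_perms_def
    by (intro sum.cong refl) (simp only: mem_Collect_eq fan_sorted_Cons_less cong: conj_cong)
  also have "(\<Sum>x\<in>{x\<in>S. v < x}. ?g x) =
     (\<Sum>x\<in>{x\<in>S. v < x \<and> (\<forall>y\<in>S - {x}. v < y \<longrightarrow> R x y)}. ?g x)"
  proof (intro sum.mono_neutral_right ballI)
    fix x assume x: "x \<in> {x\<in>S. v < x} - {x\<in>S. v < x \<and> (\<forall>y\<in>S - {x}. v < y \<longrightarrow> R x y)}"
    then obtain y where y: "v < x" "y \<in> S - {x}" "v < y" "\<not> R x y" by blast
    have "\<not> fan_sorted R (v # x # w)" if "w \<in> permutations_of_set (S - {x})" for w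
      using y permutations_of_setD(1)[OF that] unfolding fan_sorted_Cons_greater[OF y(1)] by blast
    then have "{w. w \<in> permutations_of_set (S - {x}) \<and> fan_sorted R (v # x # w)} = {}" by blast
    then show "?g x = 0" by (simp only: sum.empty)
  qed (use S in auto)
  also have "\<dots> = (\<Sum>x\<in>{x\<in>S. v < x \<and> (\<forall>y\<in>S - {x}. v < y \<longrightarrow> R x y)}.
      \<Sum>w\<in>fan_perms R v (S - {x}). f (x # w))"
  proof (rule sum.cong[OF refl])
    fix x assume x: "x \<in> {x\<in>S. v < x \<and> (\<forall>y\<in>S - {x}. v < y \<longrightarrow> R x y)}"
    then have "fan_sorted R (v # x # w) \<longleftrightarrow> fan_sorted R (v # w)"
      if "w \<in> permutations_of_set (S - {x})" for w
      using permutations_of_setD(1)[OF that] fan_sorted_Cons_greater[of v x R w] by blast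
    then have "{w. w \<in> permutations_of_set (S - {x}) \<and> fan_sorted R (v # x # w)} =
        fan_perms R v (S - {x})"
      unfolding fan_perms_def by blast
    then show "?g x = (\<Sum>w\<in>fan_perms R v (S - {x}). f (x # w))" by (simp only:)
  qed
  finally show ?thesis .
qed

text \<open>Ranks run once through 0, ..., \<open>card A - 1\<close>; adding a maximum leaves the
  other ranks unchanged.\<close>

lemma sum_card_less:
  fixes A :: "'a::linorder set"
  assumes "finite A"
  shows "(\<Sum>x\<in>A. f (card {y\<in>A. y < x})) = (\<Sum>j<card A. f j)"
  using assms
proof (induction A rule: finite_linorder_max_induct)
  case (insert b A)
  have "{y \<in> insert b A. y < x} = {y\<in>A. y < x}" if "x \<in> A" for x
    using insert.hyps that by auto
  then have "(\<Sum>x\<in>A. f (card {y \<in> insert b A. y < x})) = (\<Sum>j<card A. f j)"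
    unfolding insert.IH[symmetric] by (intro sum.cong refl) simp
  moreover have "{y \<in> insert b A. y < b} = A" using insert.hyps by auto
  moreover have b: "b \<notin> A" using insert.hyps by auto
  ultimately show ?case
    unfolding sum.insert[OF insert.hyps(1) b] card_insert_disjoint[OF insert.hyps(1) b]
    by (simp only: sum.lessThan_Suc add.commute)
qed simp

lemma length_filter_permutations_of_set:
  "w \<in> permutations_of_set S \<Longrightarrow> length (filter P w) = card {y\<in>S. P y}"
  using distinct_card[of "filter P w"] by (simp add: permutations_of_setD)

text \<open>Here \<open>z\<close> is the forced entry among the \<open>b\<close> remaining entries \<open>B\<close> above \<open>v\<close>, and \<open>e b\<close> is the
  number of larger entries that follow it.\<close>

lemma fan_perms_enum:
  fixes R :: "'a::linorder \<Rightarrow> 'a \<Rightarrow> bool" and H :: "nat \<Rightarrow> rat fps" and e :: "nat \<Rightarrow> nat"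
  assumes R: "\<And>B. finite B \<Longrightarrow> B \<noteq> {} \<Longrightarrow>
      \<exists>z. {x\<in>B. \<forall>y\<in>B - {x}. R x y} = {z} \<and> card {y\<in>B. z < y} = e (card B)"
    and H: "\<And>b. H b = fps_X * H (Suc b)
      + (if b = 0 then 0 else H (b - 1) + fps_const (of_nat (e b choose k)) * catalan_fps ^ b)
      + fps_X * fps_const (of_nat (b choose k) - of_nat (e (Suc b) choose k)) * catalan_fps ^ Suc b"
    and "finite S" "v \<notin> S"
  shows "of_nat (card (fan_perms R v S)) = catalan_fps ^ Suc (card {y\<in>S. v < y}) $ card {y\<in>S. y < v}
    \<and> of_nat (\<Sum>w\<in>fan_perms R v S. fan_count k w) = H (card {y\<in>S. v < y}) $ card {y\<in>S. y < v}"
  using assms(3,4)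
proof (induction "card S" arbitrary: S v)
  case 0
  then have "S = {}" by simp
  moreover have "fan_perms R v {} = {[]}" by (auto simp: fan_perms_def)
  \<comment> \<open>Every surviving term of the equation for \<open>H 0\<close> has a factor
    t.\<close>
  moreover have "H 0 $ 0 = 0" by (subst H) (simp add: mult.assoc)
  moreover have "catalan_fps $ 0 = 1" by (simp add: catalan_fps_def)
  ultimately show ?case by simp
next
  case (Suc n)
  define L where "L = {x\<in>S. x < v}"
  define B where "B = {x\<in>S. v < x}"
  define a where "a = card L"
  define b where "b = card B"
  have fin: "finite S" "finite L" "finite B" using Suc.prems by (auto simp: L_def B_def)
  have S: "S = L \<union> B" "L \<inter> B = {}" 
    using Suc.prems(2) linorder_less_linear[of _ v] unfolding L_def B_def by (blast, force)
  have ne: "S \<noteq> {}" using Suc.hyps by auto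
  have card_S: "card (S - {x}) = n" if "x \<in> S" for x using Suc.hyps that fin by simp
  \<comment> \<open>Above a new minimum of rank j lie all of \<open>B\<close> and the a - 1 - j
    higher elements of \<open>L\<close>.\<close>
  have greater: "card {y\<in>S. x < y} = b + a - Suc (card {y\<in>L. y < x})" if "x \<in> L" for x
  proof -
    have "L = insert x ({y\<in>L. y < x} \<union> {y\<in>L. x < y})"
      using that linorder_less_linear[of _ x] by blast
    then have "card L = card (insert x ({y\<in>L. y < x} \<union> {y\<in>L. x < y}))" by (rule arg_cong)
    also have "\<dots> = Suc (card ({y\<in>L. y < x} \<union> {y\<in>L. x < y}))"
      by (rule card_insert_disjoint) (use fin in auto)
    also have "card ({y\<in>L. y < x} \<union> {y\<in>L. x < y}) = card {y\<in>L. y < x} + card {y\<in>L. x < y}"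
      by (rule card_Un_disjoint) (use fin in auto)
    finally have "a = Suc (card {y\<in>L. y < x}) + card {y\<in>L. x < y}" by (simp add: a_def)
    moreover have "{y\<in>S. x < y} = B \<union> {y\<in>L. x < y}"
      using that Suc.prems(2) by (auto simp: L_def B_def not_less le_less)
    then have "card {y\<in>S. x < y} = b + card {y\<in>L. x < y}"
      using fin S(2) unfolding b_def by (simp only:) (rule card_Un_disjoint, auto)
    ultimately show ?thesis by simp
  qed
  have small: "of_nat (card (fan_perms R x (S - {x}))) =
        catalan_fps ^ (b + a - card {y\<in>L. y < x}) $ card {y\<in>L. y < x}"
      "of_nat (\<Sum>w\<in>fan_perms R x (S - {x}). fan_count k w) =
        H (b + a - Suc (card {y\<in>L. y < x})) $ card {y\<in>L. y < x}" if "x \<in> L" for x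
  proof -
    have "{y\<in>S - {x}. x < y} = {y\<in>S. x < y}" "{y\<in>S - {x}. y < x} = {y\<in>L. y < x}"
      using that by (auto simp: L_def)
    \<comment> \<open>This bound makes the truncated subtraction exact.\<close>
    moreover have "card {y\<in>L. y < x} < a"
      using that fin unfolding a_def by (intro psubset_card_mono) auto
    then have "Suc (b + a - Suc (card {y\<in>L. y < x})) = b + a - card {y\<in>L. y < x}" by simp
    ultimately show "of_nat (card (fan_perms R x (S - {x}))) =
        catalan_fps ^ (b + a - card {y\<in>L. y < x}) $ card {y\<in>L. y < x}"
      "of_nat (\<Sum>w\<in>fan_perms R x (S - {x}). fan_count k w) =
        H (b + a - Suc (card {y\<in>L. y < x})) $ card {y\<in>L. y < x}"
      using Suc.hyps(1)[of "S - {x}" x] card_S[of x] that fin greater[OF that]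
      by (auto simp: L_def simp del: power_Suc)
  qed
  let ?M = "{x\<in>S. v < x \<and> (\<forall>y\<in>S - {x}. v < y \<longrightarrow> R x y)}"
  have M: "?M = {x\<in>B. \<forall>y\<in>B - {x}. R x y}" by (auto simp: B_def)
  have first: "(\<Sum>w\<in>fan_perms R v S. f w) = (\<Sum>x\<in>L. \<Sum>w\<in>fan_perms R x (S - {x}). f (x # w)) +
    (\<Sum>x\<in>?M. \<Sum>w\<in>fan_perms R v (S - {x}). f (x # w))" for f :: "'a list \<Rightarrow> nat"
    unfolding L_def by (rule sum_fan_perms) (use Suc.prems ne in auto)
  have big: "of_nat (\<Sum>x\<in>?M. card (fan_perms R v (S - {x}))) = (catalan_fps ^ b $ a :: rat) \<and>
      of_nat (\<Sum>x\<in>?M. \<Sum>w\<in>fan_perms R v (S - {x}). fan_count k (x # w)) =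
      (if b = 0 then 0 else H (b - 1) $ a + of_nat (e b choose k) * catalan_fps ^ b $ a)"
  proof (cases "b = 0")
    case True
    then have "B = {}" using fin by (simp add: b_def)
    then have M_empty: "?M = {}" unfolding M by simp
    \<comment> \<open>Without entries above \<open>v\<close>, nonemptiness of \<open>S\<close>
      forces a > 0, where C^0 has coefficient 0.\<close>
    have "L \<noteq> {}" using S(1) ne \<open>B = {}\<close> by blast
    then have "a > 0" using fin by (simp add: a_def card_gt_0_iff)
    then show ?thesis using True unfolding M_empty by simp
  next
    case False
    then have "B \<noteq> {}" by (auto simp: b_def)
    then obtain z where z: "?M = {z}" "card {y\<in>B. z < y} = e b"
      using R[OF fin(3)] unfolding M b_def by blast
    then have zB: "z \<in> B" using M by blast
    then have zS: "z \<in> S" by (simp add: B_def)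
    have card_B: "card (B - {z}) = b - 1" using zB fin by (simp add: b_def)
    have sets: "{y\<in>S - {z}. v < y} = B - {z}" "{y\<in>S - {z}. y < v} = L"
      "{y\<in>S - {z}. z < y} = {y\<in>B. z < y}"
      using zB by (auto simp: B_def L_def)
    have IH: "of_nat (card (fan_perms R v (S - {z}))) = catalan_fps ^ b $ a"
      "of_nat (\<Sum>w\<in>fan_perms R v (S - {z}). fan_count k w) = H (b - 1) $ a"
      using Suc.hyps(1)[of "S - {z}" v] card_S[OF zS] Suc.prems False
      unfolding sets card_B a_def[symmetric] by simp_all
    \<comment> \<open>Whatever the order of \<open>w\<close>, the same \<open>e b\<close> larger
      entries follow \<open>z\<close>.\<close>
    have "(\<Sum>w\<in>fan_perms R v (S - {z}). fan_count k (z # w)) =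
        (\<Sum>w\<in>fan_perms R v (S - {z}). (e b choose k) + fan_count k w)"
      by (intro sum.cong refl)
        (auto simp: fan_perms_def length_filter_permutations_of_set sets z simp del: Diff_iff)
    then have "of_nat (\<Sum>w\<in>fan_perms R v (S - {z}). fan_count k (z # w)) =
        of_nat (e b choose k) * catalan_fps ^ b $ a + H (b - 1) $ a"
      by (simp only: sum.distrib of_nat_add IH(2)) (simp add: IH(1)[symmetric])
    then show ?thesis using False IH(1) unfolding z(1) by simp
  qed
  have "of_nat (card (fan_perms R v S)) = (\<Sum>x\<in>L. of_nat (card (fan_perms R x (S - {x})))) +
      (catalan_fps ^ b $ a :: rat)"
    using first[of "\<lambda>_. 1"] big by simp
  also have "\<dots> = catalan_fps ^ Suc b $ a"
    by (simp only: small catalan_power_nth a_def sum_card_less[OF fin(2),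
          of "\<lambda>j. catalan_fps ^ (b + card L - j) $ j"] cong: sum.cong)
  finally have 1: "of_nat (card (fan_perms R v S)) = catalan_fps ^ Suc b $ a" .
  have L: "of_nat (\<Sum>w\<in>fan_perms R x (S - {x}). fan_count k (x # w)) =
      H (b + a - Suc (card {y\<in>L. y < x})) $ card {y\<in>L. y < x} +
      of_nat (b + a - Suc (card {y\<in>L. y < x}) choose k) *
      catalan_fps ^ (b + a - card {y\<in>L. y < x}) $ card {y\<in>L. y < x}" if "x \<in> L" for x
  proof -
    have "{y\<in>S - {x}. x < y} = {y\<in>S. x < y}" by auto
    then have "length (filter (\<lambda>y. x < y) w) = b + a - Suc (card {y\<in>L. y < x})"
      if "w \<in> fan_perms R x (S - {x})" for w
      using length_filter_permutations_of_set[of w "S - {x}" "\<lambda>y. x < y"] that greater[OF \<open>x \<in> L\<close>]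
      unfolding fan_perms_def by (simp only: mem_Collect_eq)
    then have "(\<Sum>w\<in>fan_perms R x (S - {x}). fan_count k (x # w)) =
        (\<Sum>w\<in>fan_perms R x (S - {x}). (b + a - Suc (card {y\<in>L. y < x}) choose k) + fan_count k w)"
      by (simp only: fan_count.simps cong: sum.cong)
    then show ?thesis
      by (simp only: sum.distrib of_nat_add small(2)[OF that]) (simp add: small(1)[OF that, symmetric])
  qed
  have "of_nat (\<Sum>w\<in>fan_perms R v S. fan_count k w) =
      (\<Sum>x\<in>L. of_nat (\<Sum>w\<in>fan_perms R x (S - {x}). fan_count k (x # w))) +
      (if b = 0 then 0 else H (b - 1) $ a + of_nat (e b choose k) * catalan_fps ^ b $ a)"
    using big unfolding first of_nat_add of_nat_sum by simp
  \<comment> \<open>The new minima are reindexed by their rank j in \<open>L\<close>.\<close>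
  also have "(\<Sum>x\<in>L. of_nat (\<Sum>w\<in>fan_perms R x (S - {x}). fan_count k (x # w))) =
      (\<Sum>j<a. H (b + a - Suc j) $ j + of_nat (b + a - Suc j choose k) * catalan_fps ^ (b + a - j) $ j)"
    unfolding a_def sum_card_less[OF fin(2), symmetric]
    by (intro sum.cong refl) (simp only: L a_def)
  also have "\<dots> + (if b = 0 then 0 else H (b - 1) $ a + of_nat (e b choose k) * catalan_fps ^ b $ a) = H b $ a"
    by (subst add.commute) (rule first_letter_recurrence[of H "\<lambda>b. of_nat (e b choose k)"
        "\<lambda>b. of_nat (b choose k)", OF H, symmetric])
  finally have "of_nat (\<Sum>w\<in>fan_perms R v S. fan_count k w) = H b $ a" .
  with 1 show ?case by (simp add: a_def b_def L_def B_def)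
qed

subsection \<open>Pattern occurrences\<close>

text \<open>Common shape of all patterns involved: a least first entry, then \<open>j\<close>
  entries ordered by \<open>R\<close>. It covers the counted patterns and, with j = 2, the avoided
  ones.\<close>

definition fan_pattern :: "(nat \<Rightarrow> nat \<Rightarrow> bool) \<Rightarrow> nat \<Rightarrow> nat list \<Rightarrow> bool" where
  "fan_pattern R j \<tau> \<longleftrightarrow> length \<tau> = Suc j \<and> (\<forall>x w. distinct (x # w) \<longrightarrow>
     (red (x # w) = \<tau> \<longleftrightarrow> length w = j \<and> (\<forall>y\<in>set w. x < y) \<and> sorted_wrt R w))"

text \<open>The rank map is strictly increasing from the entries onto {1, ...,
  \<open>length w\<close>}, so \<open>red w\<close> is sorted exactly when \<open>w\<close> is, and
  a strictly sorted list is determined by its set.\<close>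

lemma red_eq_inc_pat_iff:
  fixes w :: "'a::linorder list"
  assumes "distinct w"
  shows "red w = inc_pat j \<longleftrightarrow> length w = j \<and> sorted_wrt (<) w"
proof -
  define f where "f = (\<lambda>x. card {y \<in> set w. y \<le> x})"
  have red: "red w = map f w" by (simp add: red_def f_def)
  have mono: "f x < f y" if "x < y" "y \<in> set w" for x y
  proof -
    have "{u \<in> set w. u \<le> x} \<subseteq> {u \<in> set w. u \<le> y}" using that by auto
    moreover have "y \<in> {u \<in> set w. u \<le> y} - {u \<in> set w. u \<le> x}" using that by auto
    ultimately show ?thesis unfolding f_def by (intro psubset_card_mono) (simp, blast)
  qed
  have iff: "f x < f y \<longleftrightarrow> x < y" if "x \<in> set w" "y \<in> set w" for x y
    using mono[of x y] mono[of y x] that by (cases x y rule: linorder_cases) auto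
  have inj: "inj_on f (set w)"
  proof (rule inj_onI)
    fix x y assume "x \<in> set w" "y \<in> set w" "f x = f y"
    then show "x = y" using iff[of x y] iff[of y x] by (metis less_irrefl linorder_neqE)
  qed
  have "f ` set w \<subseteq> {1..length w}"
  proof
    fix i assume "i \<in> f ` set w"
    then obtain x where x: "x \<in> set w" "i = f x" by auto
    have "f x \<le> card (set w)" unfolding f_def by (intro card_mono) auto
    moreover have "f x > 0" unfolding f_def using x by (auto simp: card_gt_0_iff)
    ultimately show "i \<in> {1..length w}" using x assms distinct_card[of w] by auto
  qed
  moreover have "card (f ` set w) = card {1..length w}"
    using card_image[OF inj] assms distinct_card[of w] by simp
  ultimately have img: "f ` set w = {1..length w}" by (intro card_subset_eq) auto
  have sorted: "sorted_wrt (<) (map f w) \<longleftrightarrow> sorted_wrt (<) w"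
    unfolding sorted_wrt_map
    using sorted_wrt_mono_rel[of w "\<lambda>x y. f x < f y" "(<)"]
      sorted_wrt_mono_rel[of w "(<)" "\<lambda>x y. f x < f y"] iff by auto
  show ?thesis
  proof
    assume *: "red w = inc_pat j"
    then have "length (map f w) = length [1..<Suc j]" unfolding red inc_pat_def by (rule arg_cong)
    then have "length w = j" by (simp del: upt_Suc)
    moreover have "sorted_wrt (<) (map f w)" using * by (simp add: red inc_pat_def del: upt_Suc)
    ultimately show "length w = j \<and> sorted_wrt (<) w" using sorted by simp
  next
    assume *: "length w = j \<and> sorted_wrt (<) w"
    then have "sorted_wrt (<) (map f w)" using sorted by simp
    moreover have "set (map f w) = set [1..<Suc j]" using img * by (auto simp del: upt_Suc)
    ultimately show "red w = inc_pat j"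
      unfolding red inc_pat_def by (intro strict_sorted_equal) (simp_all del: upt_Suc)
  qed
qed

lemma fan_pattern_inc_pat: "fan_pattern (<) j (inc_pat (Suc j))"
proof -
  have "length (inc_pat (Suc j)) = Suc j" by (simp add: inc_pat_def del: upt_Suc)
  then show ?thesis unfolding fan_pattern_def by (auto simp: red_eq_inc_pat_iff)
qed

text \<open>Ranks depend only on the set of entries, so reversing the tail reduces this to the
  increasing pattern.\<close>

lemma fan_pattern_one_dec_pat: "fan_pattern (>) j (one_dec_pat (Suc j))"
  unfolding fan_pattern_def
proof (intro conjI allI impI)
  show "length (one_dec_pat (Suc j)) = Suc j" by (simp add: one_dec_pat_def del: upt_Suc)
  fix x :: nat and w :: "nat list"
  assume d: "distinct (x # w)"
  have inc: "inc_pat (Suc j) = 1 # [2..<Suc (Suc j)]"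
    by (simp add: inc_pat_def upt_rec numeral_2_eq_2)
  have "red (x # w) = one_dec_pat (Suc j) \<longleftrightarrow> red (x # rev w) = inc_pat (Suc j)"
    unfolding one_dec_pat_def inc red_def by (auto simp: rev_swap rev_map[symmetric] simp del: upt_Suc)
  also have "\<dots> \<longleftrightarrow> length w = j \<and> (\<forall>y\<in>set w. x < y) \<and> sorted_wrt (>) w"
    using d by (auto simp: red_eq_inc_pat_iff sorted_wrt_rev)
  finally show "red (x # w) = one_dec_pat (Suc j) \<longleftrightarrow>
     length w = j \<and> (\<forall>y\<in>set w. x < y) \<and> sorted_wrt (>) w" .
qed

text \<open>Index sets avoiding position 0 are shifts of those for \<open>\<sigma>\<close>; in the
  others, \<open>x\<close> plays the least entry of the pattern.\<close>

lemma occr_Cons: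
  assumes "fan_pattern R j \<tau>" "distinct (x # \<sigma>)"
  shows "occr \<tau> (x # \<sigma>) = occr \<tau> \<sigma> + card {I. I \<subseteq> {..<length \<sigma>} \<and> card I = j \<and>
    (\<forall>y\<in>set (nths \<sigma> I). x < y) \<and> sorted_wrt R (nths \<sigma> I)}"
proof -
  define A where "A = {I. I \<subseteq> {..<length \<sigma>} \<and> card I = Suc j \<and> red (nths \<sigma> I) = \<tau>}"
  define B where "B = {I. I \<subseteq> {..<length \<sigma>} \<and> card I = j \<and>
    (\<forall>y\<in>set (nths \<sigma> I). x < y) \<and> sorted_wrt R (nths \<sigma> I)}"
  define Z where "Z = (\<lambda>I. insert (0::nat) (Suc ` I))"
  have len: "length \<tau> = Suc j" using assms by (simp add: fan_pattern_def)
  have shift: "nths (x # \<sigma>) (Suc ` I) = nths \<sigma> I" "nths (x # \<sigma>) (Z I) = x # nths \<sigma> I" for I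
    by (simp_all add: nths_Cons Z_def image_iff)
  have length: "length (nths \<sigma> I) = card I" if "I \<subseteq> {..<length \<sigma>}" for I
    unfolding length_nths using that by (intro arg_cong[of _ _ card]) auto
  have card_Z: "card (Z I) = Suc (card I)" if "I \<subseteq> {..<length \<sigma>}" for I
    unfolding Z_def using that finite_subset[OF that] by (simp add: card_image)
  have Z_mem: "red (nths (x # \<sigma>) (Z I)) = \<tau> \<longleftrightarrow>
      (\<forall>y\<in>set (nths \<sigma> I). x < y) \<and> sorted_wrt R (nths \<sigma> I)"
    if "I \<subseteq> {..<length \<sigma>}" "card I = j" for I
  proof -
    have "distinct (x # nths \<sigma> I)" using assms(2) by auto
    then show ?thesis using assms(1) length that unfolding shift fan_pattern_def by auto
  qed
  have "{I. I \<subseteq> {..<length (x # \<sigma>)} \<and> card I = Suc j \<and> red (nths (x # \<sigma>) I) = \<tau>} =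
      (`) Suc ` A \<union> Z ` B"
  proof (intro equalityI subsetI)
    fix I assume I: "I \<in> {I. I \<subseteq> {..<length (x # \<sigma>)} \<and> card I = Suc j \<and> red (nths (x # \<sigma>) I) = \<tau>}"
    define I' where "I' = {i. Suc i \<in> I}"
    have I': "I' \<subseteq> {..<length \<sigma>}" using I by (auto simp: I'_def)
    show "I \<in> (`) Suc ` A \<union> Z ` B"
    proof (cases "0 \<in> I")
      case True
      then have eq: "I = Z I'" unfolding Z_def I'_def by (auto simp: image_iff) (metis not0_implies_Suc)
      then have "I' \<in> B" using I I' card_Z[OF I'] Z_mem[OF I'] unfolding B_def by simp
      then show ?thesis using eq by blast
    next
      case False
      then have eq: "I = Suc ` I'" unfolding I'_def by (auto simp: image_iff) (metis not0_implies_Suc)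
      then have "I' \<in> A" using I I' unfolding A_def eq by (simp add: card_image shift)
      then show ?thesis using eq by blast
    qed
  next
    fix I assume "I \<in> (`) Suc ` A \<union> Z ` B"
    then consider J where "J \<in> A" "I = Suc ` J" | J where "J \<in> B" "I = Z J" by blast
    then show "I \<in> {I. I \<subseteq> {..<length (x # \<sigma>)} \<and> card I = Suc j \<and> red (nths (x # \<sigma>) I) = \<tau>}"
    proof cases
      case 1
      then show ?thesis unfolding A_def by (auto simp: card_image shift)
    next
      case 2
      then have J: "J \<subseteq> {..<length \<sigma>}" "card J = j" by (auto simp: B_def)
      then have "Z J \<subseteq> {..<length (x # \<sigma>)}" by (auto simp: Z_def)
      then show ?thesis using 2 J card_Z[OF J(1)] Z_mem[OF J] by (simp add: B_def)
    qed
  qed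
  moreover have "card ((`) Suc ` A \<union> Z ` B) = card A + card B"
  proof (subst card_Un_disjoint)
    show "finite ((`) Suc ` A)" "finite (Z ` B)" unfolding A_def B_def by auto
    show "(`) Suc ` A \<inter> Z ` B = {}" by (auto simp: Z_def)
    have "inj_on ((`) Suc) A" by (auto simp: inj_on_def)
    moreover have "inj_on Z B" by (auto simp: inj_on_def Z_def)
    ultimately show "card ((`) Suc ` A) + card (Z ` B) = card A + card B" by (simp add: card_image)
  qed
  ultimately show ?thesis unfolding occr_def len A_def B_def by simp
qed

text \<open>In terms of pairs, sortedness visibly passes to subsequences.\<close>

lemma sorted_wrt_iff_subseq: "sorted_wrt P xs \<longleftrightarrow> (\<forall>a b. subseq [a, b] xs \<longrightarrow> P a b)"
proof (induction xs)
  case (Cons x xs)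
  have "subseq [a, b] (x # xs) \<longleftrightarrow> a = x \<and> b \<in> set xs \<or> subseq [a, b] xs" for a b
    by (auto simp: subseq_singleton_left dest: subseq_Cons')
  then show ?case using Cons by auto
qed simp

text \<open>The larger entries after \<open>x\<close> are already ordered by \<open>R\<close>, so
  every choice of \<open>j\<close> of their positions completes an occurrence.\<close>

lemma occr_eq_fan_count:
  assumes "fan_pattern R j \<tau>" "distinct \<sigma>" "fan_sorted R \<sigma>"
  shows "occr \<tau> \<sigma> = fan_count j \<sigma>"
  using assms(2,3)
proof (induction \<sigma>)
  case Nil
  have "{I. I \<subseteq> {..<length []} \<and> card I = length \<tau> \<and> red (nths [] I) = \<tau>} = {}"
    using assms(1) by (auto simp: fan_pattern_def)
  then show ?case unfolding occr_def by simp
next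
  case (Cons x \<sigma>)
  define J where "J = {i. i < length \<sigma> \<and> x < \<sigma> ! i}"
  have "{I. I \<subseteq> {..<length \<sigma>} \<and> card I = j \<and> (\<forall>y\<in>set (nths \<sigma> I). x < y) \<and>
      sorted_wrt R (nths \<sigma> I)} = {I. I \<subseteq> J \<and> card I = j}"
  proof -
    have 1: "sorted_wrt R (nths \<sigma> I)" if "\<forall>y\<in>set (nths \<sigma> I). x < y" for I
    proof -
      have "subseq (nths \<sigma> I) \<sigma>" by (auto simp: subseq_conv_nths)
      then have "subseq (filter (\<lambda>y. x < y) (nths \<sigma> I)) (filter (\<lambda>y. x < y) \<sigma>)"
        by (rule subseq_filter)
      then have "subseq (nths \<sigma> I) (filter (\<lambda>y. x < y) \<sigma>)"
        using that by simp
      then show ?thesis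
        using Cons.prems(2) unfolding sorted_wrt_iff_subseq fan_sorted.simps
        by (metis subseq_order.order_trans)
    qed
    have 2: "I \<subseteq> {..<length \<sigma>} \<and> (\<forall>y\<in>set (nths \<sigma> I). x < y) \<longleftrightarrow> I \<subseteq> J" for I
      unfolding J_def set_nths by auto
    show ?thesis
    proof (rule Collect_cong)
      show "I \<subseteq> {..<length \<sigma>} \<and> card I = j \<and> (\<forall>y\<in>set (nths \<sigma> I). x < y) \<and>
        sorted_wrt R (nths \<sigma> I) \<longleftrightarrow> I \<subseteq> J \<and> card I = j" for I
        using 1[of I] 2[of I] by argo
    qed
  qed
  moreover have "finite J" "card J = length (filter (\<lambda>y. x < y) \<sigma>)"
    unfolding J_def length_filter_conv_card by auto
  ultimately show ?case
    using Cons occr_Cons[OF assms(1) Cons.prems(1)] by (simp add: n_subsets)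
qed

lemma subseq_pair_filter:
  "subseq [a, b] (filter P xs) \<longleftrightarrow> P a \<and> P b \<and> subseq [a, b] xs"
proof
  assume *: "subseq [a, b] (filter P xs)"
  then obtain N where "[a, b] = nths (filter P xs) N" unfolding subseq_conv_nths by blast
  then have "set [a, b] \<subseteq> set (filter P xs)" by (metis set_nths_subset)
  moreover have "subseq [a, b] xs" using * subseq_filter_left by (rule subseq_order.order_trans)
  ultimately show "P a \<and> P b \<and> subseq [a, b] xs" by simp
next
  assume "P a \<and> P b \<and> subseq [a, b] xs"
  then show "subseq [a, b] (filter P xs)" using subseq_filter[of "[a, b]" xs P] by simp
qed

lemma ex_nths_pair_iff:
  "(\<exists>I. I \<subseteq> {..<length xs} \<and> card I = 2 \<and> Q (nths xs I)) \<longleftrightarrow> (\<exists>a b. subseq [a, b] xs \<and> Q [a, b])"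
proof
  assume "\<exists>I. I \<subseteq> {..<length xs} \<and> card I = 2 \<and> Q (nths xs I)"
  then obtain I where I: "I \<subseteq> {..<length xs}" "card I = 2" "Q (nths xs I)" by blast
  have "{i. i < length xs \<and> i \<in> I} = I" using I(1) by auto
  then have "length (nths xs I) = 2" using I(2) by (simp add: length_nths)
  then obtain a b where "nths xs I = [a, b]"
    by (metis (no_types, opaque_lifting) One_nat_def Suc_1 length_0_conv length_Suc_conv)
  then show "\<exists>a b. subseq [a, b] xs \<and> Q [a, b]" using I(3) subseq_conv_nths by metis
next
  assume "\<exists>a b. subseq [a, b] xs \<and> Q [a, b]"
  then obtain a b N where N: "[a, b] = nths xs N" "Q [a, b]" using subseq_conv_nths by metis
  \<comment> \<open>The witness \<open>N\<close> may contain positions beyond the list and is cut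
    down first.\<close>
  let ?I = "{i. i < length xs \<and> i \<in> N}"
  have "nths xs ?I = nths xs N"
    unfolding nths_def by (intro arg_cong[of _ _ "map fst"] filter_cong) (auto dest: set_zip_rightD)
  moreover have "card ?I = 2" using arg_cong[OF N(1), where f = length] by (simp add: length_nths)
  ultimately show "\<exists>I. I \<subseteq> {..<length xs} \<and> card I = 2 \<and> Q (nths xs I)"
    using N by (intro exI[of _ ?I]) auto
qed

text \<open>An occurrence is an entry followed by two larger ones in relation \<open>R\<close>; for
  distinct entries its absence means that all such pairs satisfy \<open>R'\<close>.\<close>

lemma occr_eq_0_iff_fan_sorted:
  assumes pat: "fan_pattern R 2 \<tau>" and opp: "\<And>x y. x \<noteq> y \<Longrightarrow> R' x y \<longleftrightarrow> \<not> R x y"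
    and "distinct \<sigma>"
  shows "occr \<tau> \<sigma> = 0 \<longleftrightarrow> fan_sorted R' \<sigma>"
  using assms(3)
proof (induction \<sigma>)
  case Nil
  have "{I. I \<subseteq> {..<length []} \<and> card I = length \<tau> \<and> red (nths [] I) = \<tau>} = {}"
    using pat by (auto simp: fan_pattern_def)
  then show ?case unfolding occr_def by simp
next
  case (Cons x \<sigma>)
  let ?A = "{I. I \<subseteq> {..<length \<sigma>} \<and> card I = 2 \<and> (\<forall>y\<in>set (nths \<sigma> I). x < y) \<and>
    sorted_wrt R (nths \<sigma> I)}"
  have "finite ?A" by (rule finite_subset[of _ "Pow {..<length \<sigma>}"]) auto
  then have "card ?A = 0 \<longleftrightarrow> \<not> (\<exists>I. I \<subseteq> {..<length \<sigma>} \<and> card I = 2 \<and>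
      ((\<forall>y\<in>set (nths \<sigma> I). x < y) \<and> sorted_wrt R (nths \<sigma> I)))"
    by auto
  also have "\<dots> \<longleftrightarrow> \<not> (\<exists>a b. subseq [a, b] \<sigma> \<and> (\<forall>y\<in>set [a, b]. x < y) \<and> sorted_wrt R [a, b])"
    unfolding ex_nths_pair_iff[of \<sigma> "\<lambda>l. (\<forall>y\<in>set l. x < y) \<and> sorted_wrt R l"] ..
  also have "\<dots> \<longleftrightarrow> (\<forall>a b. subseq [a, b] (filter (\<lambda>y. x < y) \<sigma>) \<longrightarrow> \<not> R a b)"
    unfolding subseq_pair_filter by auto
  also have "\<dots> \<longleftrightarrow> sorted_wrt R' (filter (\<lambda>y. x < y) \<sigma>)"
  proof -
    have "a \<noteq> b" if ab: "subseq [a, b] (filter (\<lambda>y. x < y) \<sigma>)" for a b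
    proof -
      obtain N where "[a, b] = nths (filter (\<lambda>y. x < y) \<sigma>) N"
        using ab unfolding subseq_conv_nths by blast
      then have "distinct [a, b]" using Cons.prems by (metis distinct.simps(2) distinct_filter distinct_nthsI)
      then show ?thesis by simp
    qed
    then show ?thesis unfolding sorted_wrt_iff_subseq using opp by blast
  qed
  finally show ?case using Cons occr_Cons[OF pat Cons.prems] by auto
qed

section \<open>Generating functions of the two families\<close>

text \<open>Start the enumeration from the fictitious minimum \<open>Suc n\<close>: all n entries
  lie below it and none above, which selects the coefficient of t^n in \<open>H 0\<close>.\<close>

lemma total_occr_fps_eq:
  fixes H :: "nat \<Rightarrow> rat fps" and e :: "nat \<Rightarrow> nat"
  assumes "fan_pattern R' 2 \<tau>" "\<And>x y. x \<noteq> y \<Longrightarrow> R x y \<longleftrightarrow> \<not> R' x y"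
    and "fan_pattern R k \<gamma>"
    and R: "\<And>B. finite B \<Longrightarrow> B \<noteq> {} \<Longrightarrow>
      \<exists>z. {x\<in>B. \<forall>y\<in>B - {x}. R x y} = {z} \<and> card {y\<in>B. z < y} = e (card B)"
    and H: "\<And>b. H b = fps_X * H (Suc b)
      + (if b = 0 then 0 else H (b - 1) + fps_const (of_nat (e b choose k)) * catalan_fps ^ b)
      + fps_X * fps_const (of_nat (b choose k) - of_nat (e (Suc b) choose k)) * catalan_fps ^ Suc b"
  shows "total_occr_fps \<tau> \<gamma> = H 0"
proof (rule fps_ext)
  fix n
  have Sn: "distinct \<sigma> \<and> set \<sigma> = {1..n}" if "\<sigma> \<in> Sn n" for \<sigma>
    using that by (simp add: Sn_def permutations_of_setD)
  have "fan_sorted R (Suc n # \<sigma>) \<longleftrightarrow> fan_sorted R \<sigma>" if "\<sigma> \<in> Sn n" for \<sigma>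
  proof -
    have "filter (\<lambda>y. Suc n < y) \<sigma> = []" using Sn[OF that] by (auto simp: filter_empty_conv)
    then show ?thesis by simp
  qed
  then have Av: "Av n \<tau> = fan_perms R (Suc n) {1..n}"
    using occr_eq_0_iff_fan_sorted[OF assms(1,2)] Sn
    unfolding Av_def fan_perms_def Sn_def[symmetric] by blast
  have "(\<Sum>\<sigma>\<in>Av n \<tau>. occr \<gamma> \<sigma>) = (\<Sum>\<sigma>\<in>fan_perms R (Suc n) {1..n}. fan_count k \<sigma>)"
    unfolding Av using Sn
    by (intro sum.cong refl occr_eq_fan_count[OF assms(3)]) (auto simp: fan_perms_def Sn_def)
  moreover have "card {y\<in>{1..n}. Suc n < y} = 0" "card {y\<in>{1..n}. y < Suc n} = n"
  proof -
    have "{y\<in>{1..n}. Suc n < y} = {}" "{y\<in>{1..n}. y < Suc n} = {1..n}" by auto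
    then show "card {y\<in>{1..n}. Suc n < y} = 0" "card {y\<in>{1..n}. y < Suc n} = n"
      by (simp_all only: card.empty card_atLeastAtMost diff_Suc_1)
  qed
  ultimately show "total_occr_fps \<tau> \<gamma> $ n = H 0 $ n"
    unfolding total_occr_fps_def fps_nth_Abs_fps
    using fan_perms_enum[OF R H, of "{1..n}" "Suc n"] by (simp only:) simp
qed

text \<open>The forced entry is the least of \<open>B\<close>, followed by \<open>card B - 1\<close>
  larger ones. Since \<open>e (Suc b)\<close> = \<open>b\<close>, the correction term
  vanishes.\<close>

lemma F_fps_inc_pat: "F_fps (inc_pat (Suc k)) = total_132 k 0"
proof (rule total_occr_fps_eq[where e = "\<lambda>b. b - 1" and k = k])
  have "one_dec_pat (Suc 2) = [1, 3, 2]" by (simp add: one_dec_pat_def upt_rec)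
  then show "fan_pattern (>) 2 [1, 3, 2]" using fan_pattern_one_dec_pat[of 2] by simp
  show "fan_pattern (<) k (inc_pat (Suc k))" by (rule fan_pattern_inc_pat)
  fix B :: "nat set" assume B: "finite B" "B \<noteq> {}"
  have lt: "Min B < y" if "y \<in> B" "y \<noteq> Min B" for y using Min_le[OF B(1) that(1)] that(2) by simp
  then have "{x\<in>B. \<forall>y\<in>B - {x}. x < y} = {Min B}"
    using Min_in[OF B] by (blast dest: less_asym)
  moreover have "{y\<in>B. Min B < y} = B - {Min B}" using lt by auto
  ultimately show "\<exists>z. {x\<in>B. \<forall>y\<in>B - {x}. x < y} = {z} \<and> card {y\<in>B. z < y} = card B - 1"
    using B by (intro exI[of _ "Min B"]) simp
next
  show "total_132 k b = fps_X * total_132 k (Suc b) + (if b = 0 then 0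
      else total_132 k (b - 1) + fps_const (of_nat (b - 1 choose k)) * catalan_fps ^ b) +
      fps_X * fps_const (of_nat (b choose k) - of_nat (Suc b - 1 choose k)) * catalan_fps ^ Suc b" for b
    using total_132_rec[of k b] by simp
qed auto

text \<open>The forced entry is the greatest of \<open>B\<close>, so no larger entry follows it, and
  for k > 0 it contributes nothing to the count.\<close>

lemma G_fps_one_dec_pat:
  assumes "k > 0"
  shows "G_fps (one_dec_pat (Suc k)) = total_123 k 0"
proof (rule total_occr_fps_eq[where e = "\<lambda>b. 0" and k = k])
  have "inc_pat (Suc 2) = [1, 2, 3]" by (simp add: inc_pat_def upt_rec)
  then show "fan_pattern (<) 2 [1, 2, 3]" using fan_pattern_inc_pat[of 2] by simp
  show "fan_pattern (>) k (one_dec_pat (Suc k))" by (rule fan_pattern_one_dec_pat)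
  fix B :: "nat set" assume B: "finite B" "B \<noteq> {}"
  have lt: "Max B > y" if "y \<in> B" "y \<noteq> Max B" for y using Max_ge[OF B(1) that(1)] that(2) by simp
  then have "{x\<in>B. \<forall>y\<in>B - {x}. x > y} = {Max B}"
    using Max_in[OF B] by (blast dest: less_asym)
  moreover have "{y\<in>B. Max B < y} = {}" using B by (auto simp: not_less)
  ultimately show "\<exists>z. {x\<in>B. \<forall>y\<in>B - {x}. x > y} = {z} \<and> card {y\<in>B. z < y} = 0"
    by (intro exI[of _ "Max B"]) (simp only: card.empty)
next
  show "total_123 k b = fps_X * total_123 k (Suc b) + (if b = 0 then 0
      else total_123 k (b - 1) + fps_const (of_nat (0 choose k)) * catalan_fps ^ b) +
      fps_X * fps_const (of_nat (b choose k) - of_nat (0 choose k)) * catalan_fps ^ Suc b" for b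
  proof -
    have "(0 choose k) = 0" using assms by simp
    then show ?thesis
      by (simp only: of_nat_0 fps_const_0_eq_0 mult_zero_left add_0_right diff_zero) (rule total_123_rec)
  qed
qed auto

theorem theorem10:
  fixes m :: nat
  assumes "m > 2"
  shows "F_fps (inc_pat m) =
           fps_X * catalan_fps * F_fps (inc_pat (m - 1)) / (1 - 2 * fps_X * catalan_fps)
       \<and> G_fps (one_dec_pat m) =
           fps_X * catalan_fps * G_fps (one_dec_pat (m - 1)) / (1 - 2 * fps_X * catalan_fps)"
proof -
  \<comment> \<open>A pattern of length \<open>Suc k\<close> has index \<open>k\<close>; the
    hypothesis on \<open>m\<close> makes the index of the shorter pattern positive, as
    \<open>G_fps_one_dec_pat\<close> requires.\<close>
  define k where "k = m - 2"
  have m: "m = Suc (Suc k)" "m - 1 = Suc k" and k: "k > 0" using assms by (auto simp: k_def)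
  show ?thesis
    using total_132_solve[of k] total_123_solve[of k] k
    unfolding m by (simp only: F_fps_inc_pat G_fps_one_dec_pat zero_less_Suc diff_Suc_1)
qed

end
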